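(* The assignment $X\mapsto MBX$ is a subfunctor of the capacity functor $M$ on the category of compacta; that is, for every compactum $X$ the set $MBX$ is closed in $MX$, and for every continuous map $f:X\to Y$ between compacta, $Mf(MBX)\subset MBY$. However, $MB$ is not a submonad of the capacity monad $\mathbb M=(M,\eta,\mu)$.
   Context: A compactum is a compact Hausdorff space; the category of compacta has compacta as objects and continuous maps as morphisms. For a compactum $X$, $\mathcal F(X)$ is the family of all closed subsets of $X$. An (upper-semicontinuous) capacity on $X$ is a function $\nu:\mathcal F(X)\to[0,1]$ such that for all closed $F,G\subset X$: (1) $\nu(X)=1$, $\nu(\emptyset)=0$; (2) if $F\subset G$ then $\nu(F)\le\nu(G)$; (3) if $\nu(F)<a$ then there is an open set $O\supset F$ such that $\nu(B)<a$ for each compact $B\subset O$. A capacity is extended to open sets $U\subset X$ by $\nu(U)=\sup\{\nu(K)\mid K\subset U,\ K \text{ closed in } X\}$. $MX$ is the set of all capacities on $X$ with the topology given by the subbase of all sets $\{c\in MX\mid c(F)<a\}$ ($F\subset X$ closed, $a\in[0,1]$) and $\{c\in MX\mid c(U)>a\}$ ($U\subset X$ open, $a\in[0,1]$); with this topology $MX$ is a compactum (known fact). For a continuous map $f:X\to Y$ of compacta, $Mf:MX\to MY$ is defined by $Mf(\nu)(A)=\nu(f^{-1}(A))$ for $A\in\mathcal F(Y)$; $M$ is an endofunctor of the category of compacta. The capacity monad is $\mathbb M=(M,\eta,\mu)$, where $\eta X:X\to MX$ is given by $\eta X(x)(F)=1$ if $x\in F$ and $0$ if $x\notin F$, and $\mu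 X:M(MX)\to MX$ is given by $$\mu X(\mathcal C)(F)=\sup\{t\in[0,1]\mid \mathcal C(\{c\in MX\mid c(F)\ge t\})\ge t\}$$ for $\mathcal C\in M(MX)$ and $F\in\mathcal F(X)$ (it is known that this is a monad). A capacity $\nu\in MX$ is balanced if $\sum_{i=1}^n\lambda_i\nu(A_i)\le 1$ for all $n$, all non-negative real numbers $\lambda_1,\dots,\lambda_n$ and all closed $A_1,\dots,A_n\subset X$ with $\sum_{i=1}^n\lambda_i\chi_{A_i}\le 1_X$ pointwise ($\chi_A$ is the characteristic function of $A$, $1_X$ the constant function $1$). $MBX\subset MX$ is the subspace of balanced capacities. $MB$ is called a submonad of $\mathbb M$ if for every compactum $X$ one has $\eta X(X)\subset MBX$ and $\mu X$ maps $MB(MBX)$ into $MBX$; here $MB(MBX)$ is regarded as a subset of $M(MX)$ via the map $Mj$ induced by the inclusion $j:MBX\to MX$, so that for $\mathcal C\in MB(MBX)$ one has $\mu X(\mathcal C)(F)=\sup\{t\in[0,1]\mid \mathcal C(\{c\in MBX\mid c(F)\ge t\})\ge t\}$. *)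

theory Defs
  imports "HOL-Analysis.Analysis"
begin

text \<open>
  Spaces are values of type \<open>'a topology\<close> rather than types of a topological type class, because
  the spaces of capacities on a given space have to be spaces in their own right.
\<close>

definition compactum :: "'a topology \<Rightarrow> bool" where
  "compactum X \<longleftrightarrow> compact_space X \<and> Hausdorff_space X"

text \<open>
  A capacity has domain the closed subsets of \<open>X\<close>. It is represented by a function on all sets that
  is \<open>extensional\<close>, so that equal capacities are equal as HOL functions.
\<close>

definition capacities :: "'a topology \<Rightarrow> ('a set \<Rightarrow> real) set" where
  "capacities X = {\<nu> \<in> {F. closedin X F} \<rightarrow>\<^sub>E {0..1}.
     \<nu> (topspace X) = 1 \<and> \<nu> {} = 0 \<and>
     (\<forall>F G. closedin X F \<and> closedin X G \<and> F \<subseteq> G \<longrightarrow> \<nu> F \<le> \<nu> G) \<and>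
     (\<forall>F a. closedin X F \<and> \<nu> F < a \<longrightarrow>
        (\<exists>U. openin X U \<and> F \<subseteq> U \<and> (\<forall>B. compactin X B \<and> B \<subseteq> U \<longrightarrow> \<nu> B < a)))}"

definition open_value :: "'a topology \<Rightarrow> ('a set \<Rightarrow> real) \<Rightarrow> 'a set \<Rightarrow> real" where
  "open_value X \<nu> U = Sup {\<nu> K | K. closedin X K \<and> K \<subseteq> U}"

definition M :: "'a topology \<Rightarrow> ('a set \<Rightarrow> real) topology" where
  "M X = topology_generated_by
     ({{c \<in> capacities X. c F < a} | F a. closedin X F \<and> a \<in> {0..1}} \<union>
      {{c \<in> capacities X. open_value X c U > a} | U a. openin X U \<and> a \<in> {0..1}})"

lemma topspace_M: "topspace (M X) = capacities X"
proof
  show "topspace (M X) \<subseteq> capacities X"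
    unfolding M_def topology_generated_by_topspace by blast
  have "{c \<in> capacities X. c {} < 1} = capacities X"
    by (auto simp: capacities_def)
  moreover have "{c \<in> capacities X. c {} < 1} \<subseteq> topspace (M X)"
    unfolding M_def topology_generated_by_topspace
    by (rule Union_upper, rule UnI1, rule CollectI, rule exI[of _ "{}"], rule exI[of _ 1]) simp
  ultimately show "capacities X \<subseteq> topspace (M X)"
    by simp
qed

definition M_map ::
  "'a topology \<Rightarrow> 'b topology \<Rightarrow> ('a \<Rightarrow> 'b) \<Rightarrow> ('a set \<Rightarrow> real) \<Rightarrow> 'b set \<Rightarrow> real" where
  "M_map X Y f \<nu> = (\<lambda>A\<in>{A. closedin Y A}. \<nu> {x \<in> topspace X. f x \<in> A})"

definition eta :: "'a topology \<Rightarrow> 'a \<Rightarrow> 'a set \<Rightarrow> real" where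
  "eta X x = (\<lambda>F\<in>{F. closedin X F}. if x \<in> F then 1 else 0)"

definition mu :: "'a topology \<Rightarrow> (('a set \<Rightarrow> real) set \<Rightarrow> real) \<Rightarrow> 'a set \<Rightarrow> real" where
  "mu X C = (\<lambda>F\<in>{F. closedin X F}.
     Sup {t \<in> {0..1}. C {c \<in> topspace (M X). c F \<ge> t} \<ge> t})"

definition balanced :: "'a topology \<Rightarrow> ('a set \<Rightarrow> real) \<Rightarrow> bool" where
  "balanced X \<nu> \<longleftrightarrow> (\<forall>(n::nat) (l :: nat \<Rightarrow> real) (A :: nat \<Rightarrow> 'a set).
     (\<forall>i<n. l i \<ge> 0 \<and> closedin X (A i)) \<and>
     (\<forall>x\<in>topspace X. (\<Sum>i<n. l i * indicator (A i) x) \<le> 1) \<longrightarrow>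
     (\<Sum>i<n. l i * \<nu> (A i)) \<le> 1)"

definition MB :: "'a topology \<Rightarrow> ('a set \<Rightarrow> real) topology" where
  "MB X = subtopology (M X) {\<nu> \<in> topspace (M X). balanced X \<nu>}"

text \<open>
  The submonad condition at a single space. The map \<open>M_map (MB X) (M X) id\<close> is induced by the
  inclusion of \<open>MB X\<close> into \<open>M X\<close>. The quantification over all compacta cannot range over the
  carrier type inside a formula, so it is made where the condition is used, at a fixed type.
\<close>

definition MB_submonad_at :: "'a topology \<Rightarrow> bool" where
  "MB_submonad_at X \<longleftrightarrow>
     eta X ` topspace X \<subseteq> topspace (MB X) \<and>
     (\<forall>C \<in> topspace (MB (MB X)). mu X (M_map (MB X) (M X) id C) \<in> topspace (MB X))"

end

theory Submission
  imports Defs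
begin

text \<open>
  If \<open>\<nu>\<close> violates balancedness for closed sets \<open>A\<^sub>i\<close>, then by normality each \<open>A\<^sub>i\<close> can be enlarged to
  a closed neighbourhood without destroying \<open>\<Sum> \<lambda>\<^sub>i \<chi>\<^sub>i \<le> 1\<close>, so the violation persists for all
  capacities near \<open>\<nu>\<close>. For the failure of the monad condition let \<open>X = {0, 1, 2}\<close>, let \<open>c\<^sub>j\<close> be the
  uniform measure on \<open>X - {j}\<close> and \<open>C\<close> the uniform measure on \<open>{c\<^sub>0, c\<^sub>1, c\<^sub>2}\<close>. Two of the three
  \<open>c\<^sub>j\<close> give \<open>{i}\<close> the value \<open>1/2\<close> and \<open>2/3 \<ge> 1/2\<close>, so \<open>\<mu> C {i} \<ge> 1/2\<close> for the three disjoint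
  sets \<open>{i}\<close>.
\<close>

section \<open>Elementary properties of capacities\<close>

lemma capacities_PiE: "c \<in> capacities X \<Longrightarrow> c \<in> {F. closedin X F} \<rightarrow>\<^sub>E {0..1}"
  and capacity_topspace: "c \<in> capacities X \<Longrightarrow> c (topspace X) = 1"
  and capacity_empty: "c \<in> capacities X \<Longrightarrow> c {} = 0"
  unfolding capacities_def mem_Collect_eq by (elim conjE; assumption)+

lemma capacity_mono:
  assumes "c \<in> capacities X" "closedin X F" "closedin X G" "F \<subseteq> G"
  shows "c F \<le> c G"
proof -
  have "\<forall>F G. closedin X F \<and> closedin X G \<and> F \<subseteq> G \<longrightarrow> c F \<le> c G"
    using assms(1) unfolding capacities_def mem_Collect_eq by (elim conjE)
  then show ?thesis
    using assms(2-4) by blast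
qed

lemma capacity_open_neighbourhood:
  assumes "c \<in> capacities X" "closedin X F" "c F < a"
  obtains U where "openin X U" "F \<subseteq> U" "\<And>B. compactin X B \<Longrightarrow> B \<subseteq> U \<Longrightarrow> c B < a"
proof -
  have "\<forall>F a. closedin X F \<and> c F < a \<longrightarrow>
      (\<exists>U. openin X U \<and> F \<subseteq> U \<and> (\<forall>B. compactin X B \<and> B \<subseteq> U \<longrightarrow> c B < a))"
    using assms(1) unfolding capacities_def mem_Collect_eq by (elim conjE)
  from this[rule_format, OF conjI, OF assms(2,3)] obtain U where
    U: "openin X U" "F \<subseteq> U" "\<forall>B. compactin X B \<and> B \<subseteq> U \<longrightarrow> c B < a"
    by (elim exE conjE)
  show thesis
    by (rule that[OF U(1,2)]) (rule U(3)[rule_format, OF conjI])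
qed

lemma capacitiesI:
  assumes "c \<in> {F. closedin X F} \<rightarrow>\<^sub>E {0..1}" "c (topspace X) = 1" "c {} = 0"
    and "\<And>F G. closedin X F \<Longrightarrow> closedin X G \<Longrightarrow> F \<subseteq> G \<Longrightarrow> c F \<le> c G"
    and "\<And>F a. closedin X F \<Longrightarrow> c F < a \<Longrightarrow>
      \<exists>U. openin X U \<and> F \<subseteq> U \<and> (\<forall>B. compactin X B \<and> B \<subseteq> U \<longrightarrow> c B < a)"
  shows "c \<in> capacities X"
  unfolding capacities_def mem_Collect_eq
proof (intro conjI)
  show "\<forall>F G. closedin X F \<and> closedin X G \<and> F \<subseteq> G \<longrightarrow> c F \<le> c G"
    by (intro allI impI, elim conjE, rule assms(4))
  show "\<forall>F a. closedin X F \<and> c F < a \<longrightarrow>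
      (\<exists>U. openin X U \<and> F \<subseteq> U \<and> (\<forall>B. compactin X B \<and> B \<subseteq> U \<longrightarrow> c B < a))"
    by (intro allI impI, elim conjE, rule assms(5))
qed (fact assms)+

lemma capacity_closed_nonneg: "c \<in> capacities X \<Longrightarrow> closedin X F \<Longrightarrow> 0 \<le> c F"
  and capacity_closed_le_1: "c \<in> capacities X \<Longrightarrow> closedin X F \<Longrightarrow> c F \<le> 1"
  using PiE_mem[OF capacities_PiE, of c X F] by simp_all

lemma capacity_eqI:
  assumes "c \<in> capacities X" "d \<in> capacities X" "\<And>F. closedin X F \<Longrightarrow> c F = d F"
  shows "c = d"
  by (rule PiE_ext[OF capacities_PiE[OF assms(1)] capacities_PiE[OF assms(2)]]) (simp add: assms(3))

section \<open>Values on open sets and subbasic sets of \<open>M X\<close>\<close>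

text \<open>Together with \<open>open_value_le_capacity\<close> this gives, for an open set squeezed
  between closed sets \<open>F\<close> and \<open>K\<close>, a value between \<open>c F\<close> and
  \<open>c K\<close>. Later arguments use \<open>open_value\<close> only through these two
  bounds.\<close>

lemma capacity_le_open_value:
  assumes "c \<in> capacities X" "closedin X F" "F \<subseteq> U"
  shows "c F \<le> open_value X c U"
  unfolding open_value_def
proof (rule cSup_upper)
  show "bdd_above {c K |K. closedin X K \<and> K \<subseteq> U}"
    using capacity_closed_le_1[OF assms(1)] by (intro bdd_aboveI[where M=1]) blast
qed (use assms in blast)

lemma open_value_le_capacity:
  assumes "c \<in> capacities X" "closedin X K" "U \<subseteq> K"
  shows "open_value X c U \<le> c K"
  unfolding open_value_def
proof (rule cSup_least)
  show "{c K |K. closedin X K \<and> K \<subseteq> U} \<noteq> {}"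
    using closedin_empty by blast
qed (use capacity_mono[OF assms(1) _ assms(2)] assms(3) in blast)

lemma openin_M_less:
  assumes "closedin X F" "a \<in> {0..1}"
  shows "openin (M X) {c \<in> capacities X. c F < a}"
  unfolding M_def using assms by (intro topology_generated_by_Basis) blast

lemma openin_M_greater:
  assumes "openin X U" "a \<in> {0..1}"
  shows "openin (M X) {c \<in> capacities X. open_value X c U > a}"
  unfolding M_def using assms by (intro topology_generated_by_Basis) blast

lemma closedin_M_ge:
  assumes "closedin X F" "a \<in> {0..1}"
  shows "closedin (M X) {c \<in> capacities X. c F \<ge> a}"
proof -
  have "{c \<in> capacities X. c F \<ge> a} = topspace (M X) - {c \<in> capacities X. c F < a}"
    by (auto simp: topspace_M)
  then show ?thesis
    using openin_M_less[OF assms] by (simp add: closedin_diff)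
qed

section \<open>Normality of compacta and the Hausdorff property of \<open>M X\<close>\<close>

lemma compactum_closed_neighbourhood:
  assumes "compactum X" "closedin X F" "openin X U" "F \<subseteq> U"
  obtains V K where "openin X V" "closedin X K" "F \<subseteq> V" "V \<subseteq> K" "K \<subseteq> U"
proof -
  have "normal_space X"
    using assms(1) compact_Hausdorff_or_regular_imp_normal_space
    unfolding compactum_def by blast
  from this[unfolded normal_space_alt, rule_format, of F U] assms(2-4)
  obtain V where "openin X V" "F \<subseteq> V" "X closure_of V \<subseteq> U"
    by auto
  then show thesis
    by (intro that[of V "X closure_of V"]) (auto simp: closure_of_subset openin_subset)
qed

text \<open>Choose \<open>a\<close> strictly between \<open>c F\<close> and \<open>d F\<close>.
  Upper semicontinuity of \<open>c\<close> and normality give sets F \<subseteq> V \<subseteq> K,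
  with V open and K closed, such that \<open>c K\<close> is still below \<open>a\<close>, while
  \<open>d\<close> has value above \<open>a\<close> on V. The two subbasic conditions "value on K
  below \<open>a\<close>" and "value on V above \<open>a\<close>" exclude each other because V
  \<subseteq> K.\<close>

lemma separate_capacities:
  assumes X: "compactum X" and c: "c \<in> capacities X" and d: "d \<in> capacities X"
    and F: "closedin X F" and less: "c F < d F"
  obtains S T where "openin (M X) S" "openin (M X) T" "c \<in> S" "d \<in> T" "disjnt S T"
proof -
  obtain a where a: "c F < a" "a < d F"
    using less dense by blast
  have a01: "a \<in> {0..1}"
    using a capacity_closed_nonneg[OF c F] capacity_closed_le_1[OF d F] by simp
  obtain U where U: "openin X U" "F \<subseteq> U" "\<And>B. compactin X B \<Longrightarrow> B \<subseteq> U \<Longrightarrow> c B < a"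
    using capacity_open_neighbourhood[OF c F a(1)] by blast
  obtain V K where VK: "openin X V" "closedin X K" "F \<subseteq> V" "V \<subseteq> K" "K \<subseteq> U"
    using compactum_closed_neighbourhood[OF X F U(1,2)] by blast
  have cK: "c K < a"
    using U(3) VK X closedin_compact_space unfolding compactum_def by blast
  have dV: "a < open_value X d V"
    using capacity_le_open_value[OF d F VK(3)] a by simp
  show thesis
  proof (rule that)
    show "openin (M X) {e \<in> capacities X. e K < a}"
      using openin_M_less VK a01 by blast
    show "openin (M X) {e \<in> capacities X. open_value X e V > a}"
      using openin_M_greater VK a01 by blast
    show "disjnt {e \<in> capacities X. e K < a} {e \<in> capacities X. open_value X e V > a}"
      using open_value_le_capacity[OF _ VK(2,4)] by (fastforce simp: disjnt_def)
  qed (use c d cK dV in auto)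
qed

text \<open>Distinct capacities differ on some closed set, since they are extensional. The property
  passes to \<open>MB X\<close>, where it makes finite sets closed, as required for a uniform
  measure on finitely many capacities.\<close>

lemma Hausdorff_space_M:
  assumes "compactum X"
  shows "Hausdorff_space (M X)"
  unfolding Hausdorff_space_def topspace_M
proof (intro allI impI, elim conjE)
  fix c d assume c: "c \<in> capacities X" and d: "d \<in> capacities X" and "c \<noteq> d"
  then obtain F where F: "closedin X F" and "c F \<noteq> d F"
    using capacity_eqI by blast
  then consider "c F < d F" | "d F < c F"
    by linarith
  then show "\<exists>U V. openin (M X) U \<and> openin (M X) V \<and> c \<in> U \<and> d \<in> V \<and> disjnt U V"
    using separate_capacities[OF assms c d F] separate_capacities[OF assms d c F]
    by cases (metis disjnt_sym)+
qed

section \<open>Balanced capacities and closed enlargements of weighted families\<close>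

lemma topspace_MB: "topspace (MB X) = {\<nu> \<in> capacities X. balanced X \<nu>}"
  by (auto simp: MB_def topspace_M)

lemma Hausdorff_space_MB: "compactum X \<Longrightarrow> Hausdorff_space (MB X)"
  unfolding MB_def by (intro Hausdorff_space_subtopology Hausdorff_space_M)

lemma balancedD:
  fixes n :: nat
  assumes "balanced X \<nu>" "\<And>i. i < n \<Longrightarrow> 0 \<le> l i" "\<And>i. i < n \<Longrightarrow> closedin X (A i)"
    "\<And>x. x \<in> topspace X \<Longrightarrow> (\<Sum>i<n. l i * indicator (A i) x) \<le> 1"
  shows "(\<Sum>i<n. l i * \<nu> (A i)) \<le> 1"
  using assms unfolding balanced_def by blast

text \<open>At \<open>x\<close> the sum is the total weight of the indices \<open>i\<close> with
  \<open>x\<close> in \<open>A i\<close>. As weights are non-negative, it exceeds \<open>a\<close>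
  iff \<open>x\<close> lies in all \<open>A i\<close>, i \<in> J, for some J of total weight above
  \<open>a\<close>. There are finitely many such J, so the set is closed in spite of the strict
  inequality.\<close>

lemma closedin_weighted_indicator_sum_greater:
  fixes l :: "'i \<Rightarrow> real"
  assumes "finite I" and l: "\<And>i. i \<in> I \<Longrightarrow> 0 \<le> l i" and A: "\<And>i. i \<in> I \<Longrightarrow> closedin X (A i)"
  shows "closedin X {x \<in> topspace X. (\<Sum>i\<in>I. l i * indicator (A i) x) > a}"
proof -
  define \<J> where "\<J> = {J. J \<subseteq> I \<and> sum l J > a}"
  have eq: "{x \<in> topspace X. (\<Sum>i\<in>I. l i * indicator (A i) x) > a} =
      (\<Union>J\<in>\<J>. {x \<in> topspace X. \<forall>i\<in>J. x \<in> A i})" (is "?L = ?R")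
  proof (rule set_eqI)
    fix x
    have val: "(\<Sum>i\<in>I. l i * indicator (A i) x) = sum l {i \<in> I. x \<in> A i}"
      using assms(1) by (simp add: indicator_def sum.If_cases Int_def of_bool_def if_distrib cong: if_cong)
    have "sum l J \<le> sum l {i \<in> I. x \<in> A i}" if "J \<subseteq> I" "\<forall>i\<in>J. x \<in> A i" for J
      using that assms(1) l by (intro sum_mono2) auto
    then show "x \<in> ?L \<longleftrightarrow> x \<in> ?R"
      unfolding val mem_Collect_eq UN_iff \<J>_def by (smt (verit) mem_Collect_eq subsetI)
  qed
  have "closedin X {x \<in> topspace X. \<forall>i\<in>J. x \<in> A i}" if "J \<subseteq> I" for J
  proof -
    have "{x \<in> topspace X. \<forall>i\<in>J. x \<in> A i} = topspace X \<inter> (\<Inter>i\<in>J. A i)"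
      by auto
    \<comment> \<open>Inserting the whole space covers the empty J, whose intersection would
      otherwise be \<open>UNIV\<close>.\<close>
    moreover have "closedin X (\<Inter>(insert (topspace X) (A ` J)))"
      using that A by (intro closedin_Inter) auto
    ultimately show ?thesis by simp
  qed
  moreover have "finite \<J>"
    using assms(1) by (auto simp: \<J>_def)
  ultimately show ?thesis
    unfolding eq by (intro closedin_Union) (auto simp: \<J>_def)
qed

text \<open>The sets are enlarged one at a time. After \<open>m\<close> steps the first
  \<open>m\<close> sets have been replaced by closed neighbourhoods, the others are untouched, and
  the weighted sum is still bounded by 1.\<close>

lemma enlarge_closed_family:
  fixes l :: "nat \<Rightarrow> real"
  assumes X: "compactum X" and l: "\<And>i. i < n \<Longrightarrow> 0 \<le> l i"
    and A: "\<And>i. i < n \<Longrightarrow> closedin X (A i)"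
    and le: "\<And>x. x \<in> topspace X \<Longrightarrow> (\<Sum>i<n. l i * indicator (A i) x) \<le> 1"
  obtains U K where "\<And>i. i < n \<Longrightarrow> openin X (U i) \<and> closedin X (K i) \<and> A i \<subseteq> U i \<and> U i \<subseteq> K i"
    and "\<And>x. x \<in> topspace X \<Longrightarrow> (\<Sum>i<n. l i * indicator (K i) x) \<le> 1"
proof -
  have "m \<le> n \<Longrightarrow> \<exists>U K. (\<forall>i<m. openin X (U i) \<and> A i \<subseteq> U i \<and> U i \<subseteq> K i) \<and>
      (\<forall>i<n. closedin X (K i)) \<and> (\<forall>i. m \<le> i \<longrightarrow> K i = A i) \<and>
      (\<forall>x\<in>topspace X. (\<Sum>i<n. l i * indicator (K i) x) \<le> 1)" for m
  proof (induction m)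
    case 0
    then show ?case using A le by (intro exI[of _ A]) auto
  next
    case (Suc m)
    then obtain U K where IH: "\<forall>i<m. openin X (U i) \<and> A i \<subseteq> U i \<and> U i \<subseteq> K i"
      "\<forall>i<n. closedin X (K i)" "\<forall>i. m \<le> i \<longrightarrow> K i = A i"
      "\<forall>x\<in>topspace X. (\<Sum>i<n. l i * indicator (K i) x) \<le> 1"
      by auto
    define I where "I = {..<n} - {m}"
    have split: "(\<Sum>i<n. l i * g i) = l m * g m + (\<Sum>i\<in>I. l i * g i)" for g :: "nat \<Rightarrow> real"
      unfolding I_def using Suc.prems by (intro sum.remove) auto
    \<comment> \<open>On \<open>D\<close> the other sets leave no room for the weight
      \<open>l m\<close>. It is a closed set disjoint from \<open>A m\<close>, so normality yields a
      closed neighbourhood of \<open>A m\<close> that avoids it.\<close>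
    define D where "D = {x \<in> topspace X. (\<Sum>i\<in>I. l i * indicator (K i) x) > 1 - l m}"
    have "closedin X D"
      unfolding D_def by (rule closedin_weighted_indicator_sum_greater) (use IH l in \<open>auto simp: I_def\<close>)
    moreover have "A m \<subseteq> topspace X - D"
    proof
      fix x assume x: "x \<in> A m"
      with A Suc.prems have xX: "x \<in> topspace X"
        using closedin_subset Suc_le_lessD by blast
      with IH(4) have "(\<Sum>i<n. l i * indicator (K i) x) \<le> 1" by blast
      moreover have "K m = A m" using IH(3) by blast
      ultimately have "l m + (\<Sum>i\<in>I. l i * indicator (K i) x) \<le> 1"
        using x by (simp add: split)
      then show "x \<in> topspace X - D"
        using xX by (simp add: D_def)
    qed
    ultimately obtain V L where VL: "openin X V" "closedin X L" "A m \<subseteq> V" "V \<subseteq> L" "L \<subseteq> topspace X - D"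
      using compactum_closed_neighbourhood[OF X, of "A m" "topspace X - D"] A Suc.prems
      by (metis Suc_le_lessD openin_diff openin_topspace)
    have "(\<Sum>i<n. l i * indicator ((K(m := L)) i) x) \<le> 1" if x: "x \<in> topspace X" for x
    proof -
      have *: "(\<Sum>i\<in>I. l i * indicator ((K(m := L)) i) x) = (\<Sum>i\<in>I. l i * indicator (K i) x)"
        by (intro sum.cong) (auto simp: I_def)
      show ?thesis
      \<comment> \<open>On \<open>L\<close> the remaining sum is at most \<open>1 - l m\<close>,
        because \<open>L\<close> avoids \<open>D\<close>; off \<open>L\<close> the term with index
        \<open>m\<close> vanishes and the previous bound suffices.\<close>
      proof (cases "x \<in> L")
        case True
        then have "x \<notin> D" using VL by blast
        then show ?thesis using True x by (simp add: split * D_def del: fun_upd_apply) (simp add: D_def)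
      next
        case False
        have "0 \<le> l m * indicator (K m) x"
          using l Suc.prems by simp
        moreover have "(\<Sum>i<n. l i * indicator (K i) x) \<le> 1"
          using IH x by blast
        ultimately show ?thesis
          using False unfolding split * by simp
      qed
    qed
    then show ?case
      using IH VL by (intro exI[of _ "U(m := V)"] exI[of _ "K(m := L)"]) (auto simp: less_Suc_eq)
  qed
  from this[of n] obtain U K where "\<forall>i<n. openin X (U i) \<and> A i \<subseteq> U i \<and> U i \<subseteq> K i"
    "\<forall>i<n. closedin X (K i)" "\<forall>x\<in>topspace X. (\<Sum>i<n. l i * indicator (K i) x) \<le> 1"
    by blast
  then show thesis
    by (intro that[of U K]) blast+
qed

section \<open>Closedness of the set of balanced capacities\<close>

text \<open>Near \<nu> the values on the open sets \<open>U i\<close> stay above \<theta> times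
  \<nu> of \<open>A i\<close>, hence so do the values on \<open>K i\<close>. The family
  \<open>K\<close> is still admissible, so it witnesses the failure for every nearby
  capacity.\<close>

lemma not_balanced_neighbourhood:
  assumes X: "compactum X" and \<nu>: "\<nu> \<in> capacities X" and "\<not> balanced X \<nu>"
  obtains N where "openin (M X) N" "\<nu> \<in> N" "\<And>c. c \<in> N \<Longrightarrow> \<not> balanced X c"
proof -
  obtain n :: nat and l A where *: "\<forall>i<n. 0 \<le> l i \<and> closedin X (A i)"
    "\<forall>x\<in>topspace X. (\<Sum>i<n. l i * indicator (A i) x) \<le> 1"
    and gt: "(\<Sum>i<n. l i * \<nu> (A i)) > 1"
    using assms(3) unfolding balanced_def not_all not_imp linorder_not_le by (elim exE conjE)
  have l: "\<And>i. i < n \<Longrightarrow> 0 \<le> l i" and A: "\<And>i. i < n \<Longrightarrow> closedin X (A i)"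
    and le: "\<And>x. x \<in> topspace X \<Longrightarrow> (\<Sum>i<n. l i * indicator (A i) x) \<le> 1"
    using * by blast+
  define s where "s = (\<Sum>i<n. l i * \<nu> (A i))"
  obtain U K where UK: "\<And>i. i < n \<Longrightarrow> openin X (U i) \<and> closedin X (K i) \<and> A i \<subseteq> U i \<and> U i \<subseteq> K i"
    and le': "\<And>x. x \<in> topspace X \<Longrightarrow> (\<Sum>i<n. l i * indicator (K i) x) \<le> 1"
    using enlarge_closed_family[where l = l and A = A, OF X l A le] by blast
  \<comment> \<open>The factor is below 1 so that the strict inequalities defining \<open>N\<close>
    hold at \<nu>, and above \<open>1 / s\<close> so that the violating sum stays above 1 after
    scaling.\<close>
  obtain \<theta> where \<theta>: "1 / s < \<theta>" "\<theta> < 1"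
    using gt dense[of "1 / s" 1] by (auto simp: s_def)
  have \<theta>s: "\<theta> * s > 1" and \<theta>0: "\<theta> > 0"
  proof -
    have "s > 0" using gt s_def by simp
    then show "\<theta> * s > 1" using \<theta> by (simp add: divide_less_eq)
    show "\<theta> > 0" using \<theta>(1) \<open>s > 0\<close> by (meson divide_pos_pos less_trans zero_less_one)
  qed
  \<comment> \<open>Indices with \<nu> of \<open>A i\<close> equal to 0 are left out: the strict
    condition could fail at \<nu> itself, while the lower bound wanted for \<open>c (K i)\<close> is
    then just 0.\<close>
  define J where "J = {i. i < n \<and> \<nu> (A i) > 0}"
  define N where "N = topspace (M X) \<inter>
    (\<Inter>i\<in>J. {c \<in> capacities X. open_value X c (U i) > \<theta> * \<nu> (A i)})"
  show thesis
  proof (rule that)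
    have "openin (M X) {c \<in> capacities X. open_value X c (U i) > \<theta> * \<nu> (A i)}" if "i \<in> J" for i
    proof (rule openin_M_greater)
      show "\<theta> * \<nu> (A i) \<in> {0..1}"
        using that \<theta> \<theta>0 capacity_closed_le_1[OF \<nu> A] by (auto simp: J_def intro: mult_le_one)
    qed (use that UK in \<open>auto simp: J_def\<close>)
    moreover have "finite J" by (simp add: J_def)
    ultimately have "openin (M X) (\<Inter> (insert (topspace (M X))
        ((\<lambda>i. {c \<in> capacities X. open_value X c (U i) > \<theta> * \<nu> (A i)}) ` J)))"
      by (intro openin_Inter) auto
    then show "openin (M X) N"
      by (simp add: N_def)
    have "\<theta> * \<nu> (A i) < open_value X \<nu> (U i)" if "i \<in> J" for i
    proof -
      have "\<theta> * \<nu> (A i) < \<nu> (A i)"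
        using that \<theta> by (simp add: J_def)
      also have "\<dots> \<le> open_value X \<nu> (U i)"
        using that A UK by (intro capacity_le_open_value[OF \<nu>]) (auto simp: J_def)
      finally show ?thesis .
    qed
    then show "\<nu> \<in> N"
      using \<nu> by (simp add: N_def topspace_M)
    fix c assume c: "c \<in> N"
    then have cX: "c \<in> capacities X" by (simp add: N_def topspace_M)
    have "\<theta> * \<nu> (A i) \<le> c (K i)" if i: "i < n" for i
    proof (cases "i \<in> J")
      case True
      then have "\<theta> * \<nu> (A i) < open_value X c (U i)"
        using c by (simp add: N_def)
      also have "\<dots> \<le> c (K i)"
        using UK[OF i] by (intro open_value_le_capacity[OF cX]) auto
      finally show ?thesis by simp
    next
      case False
      then have "\<nu> (A i) = 0"
        using i capacity_closed_nonneg[OF \<nu> A[OF i]] by (simp add: J_def)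
      then show ?thesis
        using capacity_closed_nonneg[OF cX] UK[OF i] by simp
    qed
    then have "(\<Sum>i<n. l i * (\<theta> * \<nu> (A i))) \<le> (\<Sum>i<n. l i * c (K i))"
      using l by (intro sum_mono mult_left_mono) auto
    moreover have "(\<Sum>i<n. l i * (\<theta> * \<nu> (A i))) = \<theta> * s"
      by (simp add: s_def sum_distrib_left ac_simps)
    ultimately have "(\<Sum>i<n. l i * c (K i)) > 1"
      using \<theta>s by linarith
    then show "\<not> balanced X c"
      using balancedD[of X c n l K] l UK le' by force
  qed
qed

lemma closedin_MB:
  assumes "compactum X"
  shows "closedin (M X) (topspace (MB X))"
proof -
  have "openin (M X) (topspace (M X) - topspace (MB X))"
  proof (subst openin_subopen, intro ballI)
    fix \<nu> assume \<nu>: "\<nu> \<in> topspace (M X) - topspace (MB X)"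
    then obtain N where "openin (M X) N" "\<nu> \<in> N" "\<And>c. c \<in> N \<Longrightarrow> \<not> balanced X c"
      using not_balanced_neighbourhood[OF assms, of \<nu>] by (auto simp: topspace_M topspace_MB)
    then show "\<exists>T. openin (M X) T \<and> \<nu> \<in> T \<and> T \<subseteq> topspace (M X) - topspace (MB X)"
      by (intro exI[of _ N]) (auto simp: topspace_MB dest: openin_subset)
  qed
  then show ?thesis
    by (auto simp: closedin_def topspace_MB topspace_M)
qed

section \<open>Functoriality: images of capacities and of balanced capacities\<close>

text \<open>Taking preimages respects closedness, inclusion, the empty set and the whole space.
  Upper semicontinuity rests on \<open>f\<close> being a closed map, as a continuous map from a
  compact to a Hausdorff space.\<close>

lemma M_map_capacities:
  assumes X: "compactum X" and Y: "compactum Y" and f: "continuous_map X Y f"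
    and \<nu>: "\<nu> \<in> capacities X"
  shows "M_map X Y f \<nu> \<in> capacities Y"
proof -
  define P where "P A = {x \<in> topspace X. f x \<in> A}" for A
  have P: "closedin X (P A)" if "closedin Y A" for A
    unfolding P_def by (rule closedin_continuous_map_preimage[OF f that])
  have val: "M_map X Y f \<nu> A = \<nu> (P A)" if "closedin Y A" for A
    using that by (simp add: M_map_def P_def)
  have fX: "f x \<in> topspace Y" if "x \<in> topspace X" for x
    using f that by (auto simp: continuous_map_def)
  have top: "P (topspace Y) = topspace X" and empty: "P {} = {}"
    using fX by (auto simp: P_def)
  have cont: "\<exists>U. openin Y U \<and> F \<subseteq> U \<and> (\<forall>B. compactin Y B \<and> B \<subseteq> U \<longrightarrow> M_map X Y f \<nu> B < a)"
    if F: "closedin Y F" and a: "M_map X Y f \<nu> F < a" for F a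
  proof -
    obtain O' where O': "openin X O'" "P F \<subseteq> O'" "\<And>B. compactin X B \<Longrightarrow> B \<subseteq> O' \<Longrightarrow> \<nu> B < a"
      using capacity_open_neighbourhood[OF \<nu> P[OF F] a[unfolded val[OF F]]] by blast
    \<comment> \<open>\<open>U\<close> consists of the points of \<open>Y\<close> whose whole fibre
      lies in \<open>O'\<close>, so the preimage of any subset of \<open>U\<close> lies in
      \<open>O'\<close>.\<close>
    define U where "U = topspace Y - f ` (topspace X - O')"
    have "closed_map X Y f"
      using X Y f continuous_imp_closed_map unfolding compactum_def by blast
    then have "closedin Y (f ` (topspace X - O'))"
      using O'(1) unfolding closed_map_def by blast
    then have "openin Y U"
      by (simp add: U_def openin_diff)
    moreover have "F \<subseteq> U"
      using O'(2) closedin_subset[OF F] by (auto simp: U_def P_def)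
    moreover have "M_map X Y f \<nu> B < a" if B: "compactin Y B" "B \<subseteq> U" for B
    proof -
      have clB: "closedin Y B"
        using B Y compactin_imp_closedin unfolding compactum_def by blast
      have "compactin X (P B)"
        using P[OF clB] X closedin_compact_space unfolding compactum_def by blast
      moreover have "P B \<subseteq> O'"
        using B(2) by (auto simp: P_def U_def)
      ultimately show ?thesis
        using O'(3) val[OF clB] by simp
    qed
    ultimately show ?thesis by blast
  qed
  have mono: "M_map X Y f \<nu> F \<le> M_map X Y f \<nu> G"
    if "closedin Y F" "closedin Y G" "F \<subseteq> G" for F G
  proof -
    have "P F \<subseteq> P G" using that by (auto simp: P_def)
    then show ?thesis
      using that by (simp add: val capacity_mono[OF \<nu> P P])
  qed
  have ext: "M_map X Y f \<nu> \<in> {F. closedin Y F} \<rightarrow>\<^sub>E {0..1}"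
  proof (rule PiE_I)
    fix F assume "F \<in> {F. closedin Y F}"
    then show "M_map X Y f \<nu> F \<in> {0..1}"
      using capacity_closed_nonneg[OF \<nu> P] capacity_closed_le_1[OF \<nu> P] by (simp add: val)
  qed (simp add: M_map_def)
  show ?thesis
    by (rule capacitiesI)
      (use ext mono cont in \<open>simp_all add: val top empty capacity_topspace[OF \<nu>] capacity_empty[OF \<nu>]\<close>)
qed

text \<open>The indicator of a preimage is the indicator of the set composed with \<open>f\<close>,
  so an admissible family on \<open>Y\<close> pulls back to an admissible family on \<open>X\<close>
  with the same weights.\<close>

lemma M_map_balanced:
  assumes f: "continuous_map X Y f" and \<nu>: "balanced X \<nu>"
  shows "balanced Y (M_map X Y f \<nu>)"
  unfolding balanced_def
proof (intro allI impI, elim conjE)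
  fix n :: nat and l :: "nat \<Rightarrow> real" and A :: "nat \<Rightarrow> 'b set"
  assume *: "\<forall>i<n. 0 \<le> l i \<and> closedin Y (A i)"
    and le: "\<forall>y\<in>topspace Y. (\<Sum>i<n. l i * indicator (A i) y) \<le> 1"
  have "(\<Sum>i<n. l i * \<nu> {x \<in> topspace X. f x \<in> A i}) \<le> 1"
  proof (rule balancedD[OF \<nu>])
    fix x assume x: "x \<in> topspace X"
    then have "f x \<in> topspace Y"
      using f by (auto simp: continuous_map_def)
    then have "(\<Sum>i<n. l i * indicator (A i) (f x)) \<le> 1"
      using le by blast
    then show "(\<Sum>i<n. l i * indicator {x \<in> topspace X. f x \<in> A i} x) \<le> 1"
      using x by (simp add: indicator_def)
  qed (use * closedin_continuous_map_preimage[OF f] in simp_all)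
  then show "(\<Sum>i<n. l i * M_map X Y f \<nu> (A i)) \<le> 1"
    using * by (simp add: M_map_def)
qed

section \<open>Uniform measures on finite sets as balanced capacities\<close>

text \<open>The normalised counting measure on a finite set \<open>S\<close>, restricted to closed
  sets. It serves at two levels: on the three-point space and on the space of balanced capacities
  over it.\<close>

definition uniform_capacity :: "'a topology \<Rightarrow> 'a set \<Rightarrow> 'a set \<Rightarrow> real" where
  "uniform_capacity X S = (\<lambda>F\<in>{F. closedin X F}. card (F \<inter> S) / card S)"

lemma uniform_capacity_eq:
  "closedin X F \<Longrightarrow> uniform_capacity X S F = card (F \<inter> S) / card S"
  by (simp add: uniform_capacity_def)

text \<open>For upper semicontinuity at \<open>F\<close>, remove from the space the finitely many
  points of \<open>S\<close> outside \<open>F\<close>. What remains is open in a Hausdorff space and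
  meets \<open>S\<close> only in points of \<open>F\<close>.\<close>

lemma uniform_capacity_capacities:
  assumes X: "Hausdorff_space X" and S: "finite S" "S \<noteq> {}" "S \<subseteq> topspace X"
  shows "uniform_capacity X S \<in> capacities X"
proof -
  \<comment> \<open>Only \<open>F \<inter> S\<close> has to lie in \<open>G\<close>: the sets
    \<open>B\<close> in the semicontinuity argument need not be contained in \<open>F\<close>, but
    their points in \<open>S\<close> are.\<close>
  have mono: "uniform_capacity X S F \<le> uniform_capacity X S G"
    if "closedin X F" "closedin X G" "F \<inter> S \<subseteq> G" for F G
    using that S by (auto simp: uniform_capacity_eq intro!: divide_right_mono card_mono)
  have "uniform_capacity X S \<in> {F. closedin X F} \<rightarrow>\<^sub>E {0..1}"
  proof (rule PiE_I)
    fix F assume "F \<in> {F. closedin X F}"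
    moreover have "card (F \<inter> S) \<le> card S"
      using S by (intro card_mono) auto
    ultimately show "uniform_capacity X S F \<in> {0..1}"
      using S by (simp add: uniform_capacity_eq divide_le_eq card_gt_0_iff)
  qed (simp add: uniform_capacity_def)
  moreover have "uniform_capacity X S (topspace X) = 1" "uniform_capacity X S {} = 0"
    using S by (auto simp: uniform_capacity_eq Int_absorb1)
  moreover have "\<exists>U. openin X U \<and> F \<subseteq> U \<and> (\<forall>B. compactin X B \<and> B \<subseteq> U \<longrightarrow> uniform_capacity X S B < a)"
    if F: "closedin X F" and a: "uniform_capacity X S F < a" for F a
  proof (intro exI conjI allI impI)
    have "closedin X (S - F)"
      using X S by (intro closedin_Hausdorff_finite) auto
    then show "openin X (topspace X - (S - F))"
      by (simp add: openin_diff)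
    show "F \<subseteq> topspace X - (S - F)"
      using closedin_subset[OF F] by blast
    fix B assume B: "compactin X B \<and> B \<subseteq> topspace X - (S - F)"
    then have "closedin X B"
      using X compactin_imp_closedin by blast
    then have "uniform_capacity X S B \<le> uniform_capacity X S F"
      using B F by (intro mono) auto
    then show "uniform_capacity X S B < a"
      using a by simp
  qed
  ultimately show ?thesis
    by (intro capacitiesI) (auto intro: mono le_infI1)
qed

text \<open>Averaging the pointwise bound over \<open>S\<close> and exchanging the two sums gives
  the claim.\<close>

lemma balanced_uniform_capacity:
  assumes S: "finite S" "S \<noteq> {}" "S \<subseteq> topspace X"
  shows "balanced X (uniform_capacity X S)"
  unfolding balanced_def
proof (intro allI impI, elim conjE)
  fix n :: nat and l :: "nat \<Rightarrow> real" and A :: "nat \<Rightarrow> 'a set"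
  assume *: "\<forall>i<n. 0 \<le> l i \<and> closedin X (A i)"
    and le: "\<forall>x\<in>topspace X. (\<Sum>i<n. l i * indicator (A i) x) \<le> 1"
  have card: "real (card (F \<inter> S)) = (\<Sum>x\<in>S. indicator F x)" for F
    using S(1) by (simp add: indicator_def Int_commute Int_def)
  have "(\<Sum>i<n. l i * uniform_capacity X S (A i)) = (\<Sum>i<n. \<Sum>x\<in>S. l i * indicator (A i) x) / card S"
    using * by (simp add: uniform_capacity_eq card sum_divide_distrib sum_distrib_left)
  also have "(\<Sum>i<n. \<Sum>x\<in>S. l i * indicator (A i) x) = (\<Sum>x\<in>S. \<Sum>i<n. l i * indicator (A i) x)"
    by (rule sum.swap)
  also have "\<dots> / card S \<le> (\<Sum>x\<in>S. 1) / card S"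
    using S le by (intro divide_right_mono sum_mono) auto
  also have "\<dots> = 1" using S by simp
  finally show "(\<Sum>i<n. l i * uniform_capacity X S (A i)) \<le> 1" .
qed

lemma uniform_capacity_MB:
  assumes "Hausdorff_space X" "finite S" "S \<noteq> {}" "S \<subseteq> topspace X"
  shows "uniform_capacity X S \<in> topspace (MB X)"
  using uniform_capacity_capacities[OF assms] balanced_uniform_capacity[OF assms(2-4)]
  by (simp add: topspace_MB)

section \<open>The three-point counterexample to the monad condition\<close>

lemma MB_not_submonad_at_three_points:
  "\<not> MB_submonad_at (discrete_topology {..<3::nat})"
proof
  define X where "X = discrete_topology {..<3::nat}"
  assume "MB_submonad_at (discrete_topology {..<3::nat})"
  then have sub: "\<And>C. C \<in> topspace (MB (MB X)) \<Longrightarrow> mu X (M_map (MB X) (M X) id C) \<in> topspace (MB X)"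
    by (simp add: MB_submonad_at_def X_def)
  have X: "compactum X" "Hausdorff_space X" "topspace X = {..<3}"
    by (auto simp: X_def compactum_def compact_space_discrete_topology)
  define c where "c j = uniform_capacity X ({..<3} - {j})" for j
  have closed: "closedin X F \<longleftrightarrow> F \<subseteq> {..<3}" for F
    by (simp add: X_def)
  have set3: "{..<3} = {0, 1, 2::nat}"
    by auto
  have c_MB: "c j \<in> topspace (MB X)" if "j < 3" for j
    unfolding c_def
  proof (rule uniform_capacity_MB)
    show "{..<3} - {j} \<noteq> {}" by (auto simp: set3)
  qed (use X in auto)
  have c_val: "c j {i} = (if i = j then 0 else 1/2)" if "i < 3" "j < 3" for i j
  proof -
    have "{i} \<inter> ({..<3} - {j}) = (if i = j then {} else {i})"
      using that by auto
    then show ?thesis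
      using that by (simp add: c_def uniform_capacity_eq closed)
  qed
  \<comment> \<open>Among the three singletons, \<open>c j\<close> vanishes exactly on
    \<open>{j}\<close>, which recovers \<open>j\<close>. Hence the support of \<open>C\<close> has
    three elements, each of weight 1/3.\<close>
  have inj: "inj_on c {..<3}"
    by (rule inj_onI) (metis c_val lessThan_iff zero_neq_one divide_eq_0_iff zero_neq_numeral)
  define C where "C = uniform_capacity (MB X) (c ` {..<3})"
  have C: "C \<in> topspace (MB (MB X))"
    unfolding C_def
  proof (rule uniform_capacity_MB)
    show "Hausdorff_space (MB X)" by (rule Hausdorff_space_MB[OF X(1)])
  qed (use c_MB set3 in auto)
  define D where "D = M_map (MB X) (M X) id C"
  have muD: "mu X D \<in> topspace (MB X)"
    unfolding D_def by (rule sub[OF C])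
  have half: "1/2 \<le> mu X D {i}" if i: "i < 3" for i
  proof -
    let ?F = "{e \<in> topspace (M X). e {i} \<ge> 1/2}"
    have F: "closedin (M X) ?F"
      unfolding topspace_M using i by (intro closedin_M_ge) (auto simp: closed)
    \<comment> \<open>\<open>D\<close> takes on \<open>?F\<close> the value of \<open>C\<close> on
      this preimage under the inclusion; closedness there allows \<open>C\<close> to be evaluated by
      counting.\<close>
    then have F': "closedin (MB X) {e \<in> topspace (MB X). id e \<in> ?F}"
      by (intro closedin_continuous_map_preimage[of "MB X" "M X"])
        (auto simp: MB_def intro: continuous_map_from_subtopology)
    have "c ` ({..<3} - {i}) \<subseteq> {e \<in> topspace (MB X). id e \<in> ?F} \<inter> c ` {..<3}"
      using i c_MB c_val by (auto simp: topspace_M topspace_MB)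
    then have "card (c ` ({..<3} - {i})) \<le> card ({e \<in> topspace (MB X). id e \<in> ?F} \<inter> c ` {..<3})"
      by (intro card_mono) auto
    moreover have "card (c ` ({..<3} - {i})) = 2"
      using i by (subst card_image[OF inj_on_subset[OF inj]]) auto
    moreover have "card (c ` {..<3}) = 3"
      using card_image[OF inj] by simp
    ultimately have "1/2 \<le> D ?F"
      using F F' by (simp add: D_def M_map_def C_def uniform_capacity_eq)
    \<comment> \<open>The measure 2/3 exceeds the level 1/2, so 1/2 is one of the numbers over which
      the supremum in \<open>mu\<close> is taken.\<close>
    then have "1/2 \<in> {t \<in> {0..1}. D {e \<in> topspace (M X). e {i} \<ge> t} \<ge> t}"
      by simp
    then have "1/2 \<le> Sup {t \<in> {0..1}. D {e \<in> topspace (M X). e {i} \<ge> t} \<ge> t}"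
      by (rule cSup_upper) (auto intro: bdd_aboveI[where M=1])
    then show ?thesis
      using i by (simp add: mu_def closed)
  qed
  \<comment> \<open>The singletons partition the space, so with weights 1 they form an admissible
    family; their values under \<open>mu X D\<close> add up to at least 3/2.\<close>
  have "(\<Sum>i<3. 1 * mu X D {i}) \<le> 1"
  proof (rule balancedD)
    show "balanced X (mu X D)"
      using muD by (simp add: topspace_MB)
    fix x assume "x \<in> topspace X"
    then have "x = 0 \<or> x = 1 \<or> x = 2"
      by (auto simp: X)
    then show "(\<Sum>i<3. 1 * indicator {i} x) \<le> (1::real)"
      by (auto simp: set3)
  qed (auto simp: closed)
  moreover have "(\<Sum>i<3::nat. 1/2) \<le> (\<Sum>i<3. 1 * mu X D {i})"
    using half by (intro sum_mono) auto
  ultimately show False by simp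
qed

theorem mainTheorem2:
  shows "(\<forall>X :: 'a topology. compactum X \<longrightarrow> closedin (M X) (topspace (MB X))) \<and>
    (\<forall>(X :: 'a topology) (Y :: 'b topology) f.
       compactum X \<and> compactum Y \<and> continuous_map X Y f \<longrightarrow>
       M_map X Y f ` topspace (MB X) \<subseteq> topspace (MB Y)) \<and>
    \<not> (\<forall>X :: nat topology. compactum X \<longrightarrow> MB_submonad_at X)"
proof (intro conjI allI impI)
  fix X :: "'a topology" assume "compactum X"
  then show "closedin (M X) (topspace (MB X))"
    by (rule closedin_MB)
next
  fix X :: "'a topology" and Y :: "'b topology" and f
  assume "compactum X \<and> compactum Y \<and> continuous_map X Y f"
  then show "M_map X Y f ` topspace (MB X) \<subseteq> topspace (MB Y)"
    by (auto simp: topspace_MB M_map_capacities M_map_balanced)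
next
  have "compactum (discrete_topology {..<3::nat})"
    by (simp add: compactum_def compact_space_discrete_topology)
  then show "\<not> (\<forall>X :: nat topology. compactum X \<longrightarrow> MB_submonad_at X)"
    using MB_not_submonad_at_three_points by blast
qed

end
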